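(* Let $V=\mathbb R^n$ and let $r,d$ be integers with $d\ge 0$ and $0<r\le n-d$. Let $W\subseteq\bigwedge^r V$ be a linear subspace and $F\in GL_n(\mathbb R)$. Then $$\max_{J\in\binom{[n]}{n-d}}\frac{\dim\pi^F_J(W)}{\binom{n-d}{r}}\ge\frac{\dim W}{\binom nr}.$$
   Context: $[n]=\{1,\dots,n\}$ and $\binom{[n]}{k}$ is the set of $k$-element subsets of $[n]$. For $F\in GL_n(\mathbb R)$ with columns $f_1,\dots,f_n$ (a basis of $V$) and $J\subseteq[n]$, let $V_J=\operatorname{span}\{f_j:j\in J\}$ and let $\pi^F_J:V\to V_J$ be the linear projection $\pi^F_J\left(\sum_{j\in[n]}\alpha_jf_j\right)=\sum_{j\in J}\alpha_jf_j$. The same symbol $\pi^F_J:\bigwedge^r V\to\bigwedge^r V_J$ denotes the induced map on exterior powers: with $f_A=\bigwedge_{a\in A}f_a$ (indices increasing), $\pi^F_J(f_A)=f_A$ if $A\subseteq J$ and $0$ otherwise. *)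

theory Defs
  imports "HOL-Analysis.Analysis"
begin

text \<open>
  The exterior algebra of \<open>V = \<real>\<^sup>n\<close> is modelled on \<^typ>\<open>real ^ 'n set\<close>: the coordinate indexed by
  \<open>S = {s\<^sub>1 < \<dots> < s\<^sub>k}\<close> is the coefficient of \<open>e\<^sub>S = e\<^bsub>s\<^sub>1\<^esub> \<and> \<dots> \<and> e\<^bsub>s\<^sub>k\<^esub>\<close>, and \<open>axis S 1\<close> is \<open>e\<^sub>S\<close>
  itself. The linearly ordered finite type \<^typ>\<open>'n\<close> plays the role of \<open>[n]\<close>.
\<close>

type_synonym 'n multivector = "real ^ 'n set"

definition ext_power :: "nat \<Rightarrow> ('n::finite) multivector set" where
  "ext_power r = {w. \<forall>S. w $ S \<noteq> 0 \<longrightarrow> card S = r}"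

definition vec_mv :: "real ^ 'n \<Rightarrow> ('n::finite) multivector" where
  "vec_mv v = (\<chi> S. if card S = 1 then v $ the_elem S else 0)"

definition wedge_sign :: "'n::linorder set \<Rightarrow> 'n set \<Rightarrow> real" where
  "wedge_sign A B = (- 1) ^ card {(a, b). a \<in> A \<and> b \<in> B \<and> b < a}"

text \<open>
  Bilinear extension of \<open>e\<^sub>A \<and> e\<^sub>B = wedge_sign A B \<cdot> e\<^bsub>A \<union> B\<^esub>\<close> for disjoint \<open>A\<close>, \<open>B\<close>, and
  \<open>e\<^sub>A \<and> e\<^sub>B = 0\<close> otherwise.
\<close>

definition wedge :: "('n::{finite,linorder}) multivector \<Rightarrow> 'n multivector \<Rightarrow> 'n multivector" where
  "wedge x y = (\<chi> S. \<Sum>A\<in>Pow S. wedge_sign A (S - A) * (x $ A * y $ (S - A)))"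

text \<open>\<open>wedge_family f A\<close> is \<open>f\<^sub>A = \<And>\<^bsub>a \<in> A\<^esub> f\<^sub>a\<close>, indices increasing.\<close>

definition wedge_family ::
    "('n \<Rightarrow> real ^ ('n::{finite,linorder})) \<Rightarrow> 'n set \<Rightarrow> 'n multivector" where
  "wedge_family f A = foldr (\<lambda>a w. wedge (vec_mv (f a)) w) (sorted_list_of_set A) (axis {} 1)"

text \<open>
  The map on the exterior algebra induced by a linear map \<open>T\<close>, i.e. the linear extension of
  \<open>e\<^sub>S \<mapsto> \<And>\<^bsub>s \<in> S\<^esub> T e\<^sub>s\<close>; it restricts to \<open>\<And>\<^sup>r T\<close> on \<open>ext_power r\<close>.
\<close>

definition ext_map ::
    "(real ^ ('n::{finite,linorder}) \<Rightarrow> real ^ ('n::{finite,linorder})) \<Rightarrow> 'n multivector \<Rightarrow> 'n multivector" where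
  "ext_map T w = (\<Sum>S\<in>UNIV. w $ S *\<^sub>R wedge_family (\<lambda>i. T (axis i 1)) S)"

text \<open>
  \<open>basis_proj F J\<close> is the projection \<open>\<Sum>\<^sub>j \<alpha>\<^sub>j f\<^sub>j \<mapsto> \<Sum>\<^bsub>j \<in> J\<^esub> \<alpha>\<^sub>j f\<^sub>j\<close> along the columns \<open>f\<^sub>j\<close> of an invertible
  \<open>F\<close> (\<open>matrix_inv F *v x\<close> is the coefficient vector \<open>\<alpha>\<close> of \<open>x\<close>). Its range \<open>V\<^sub>J\<close> is regarded as a
  subspace of \<open>V\<close>, and likewise \<open>\<And>\<^sup>r V\<^sub>J\<close> as a subspace of \<open>\<And>\<^sup>r V\<close>.
\<close>

definition basis_proj ::
    "real ^ 'n ^ 'n \<Rightarrow> 'n set \<Rightarrow> real ^ 'n \<Rightarrow> real ^ ('n::finite)" where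
  "basis_proj F J x = (\<Sum>j\<in>J. (matrix_inv F *v x) $ j *\<^sub>R column j F)"

definition ext_proj ::
    "real ^ ('n::{finite,linorder}) ^ ('n::{finite,linorder}) \<Rightarrow> 'n set \<Rightarrow> 'n multivector \<Rightarrow> 'n multivector" where
  "ext_proj F J = ext_map (basis_proj F J)"


text \<open>
  The remaining lemmas check these definitions against the usual characterisations: \<open>e\<^sub>S\<close> is the wedge
  product of the \<open>e\<^sub>s\<close>, vectors anticommute, induced maps are compatible with wedge products of vectors,
  \<open>ext_proj F J\<close> sends \<open>f\<^sub>A\<close> to \<open>f\<^sub>A\<close> or \<open>0\<close>, and the \<open>f\<^sub>A\<close> span \<open>\<And>\<^sup>r V\<close>.
\<close>

lemma vec_mv_add: "vec_mv (u + v) = vec_mv u + vec_mv v"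
  by (simp add: vec_mv_def vec_eq_iff)

lemma vec_mv_scale: "vec_mv (c *\<^sub>R v) = c *\<^sub>R vec_mv v"
  by (simp add: vec_mv_def vec_eq_iff)

lemma vec_mv_0 [simp]: "vec_mv 0 = 0"
  by (simp add: vec_mv_def vec_eq_iff)

lemma bilinear_wedge: "bilinear wedge"
  unfolding bilinear_def
  by (auto intro!: linearI simp: wedge_def vec_eq_iff algebra_simps sum.distrib sum_distrib_left)

lemma wedge_vec_nth:
  "wedge (vec_mv v) w $ S = (\<Sum>i\<in>S. (- 1) ^ card {b\<in>S. b < i} * (v $ i * w $ (S - {i})))"
proof -
  let ?g = "\<lambda>A. wedge_sign A (S - A) * (vec_mv v $ A * w $ (S - A))"
  have "wedge (vec_mv v) w $ S = sum ?g (Pow S)"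
    by (simp add: wedge_def)
  also have "\<dots> = sum ?g ((\<lambda>i. {i}) ` S)"
    by (rule sum.mono_neutral_right) (auto simp: vec_mv_def card_1_singleton_iff)
  also have "\<dots> = (\<Sum>i\<in>S. ?g {i})"
    by (subst sum.reindex) (auto simp: inj_on_def)
  also have "\<dots> = (\<Sum>i\<in>S. (- 1) ^ card {b\<in>S. b < i} * (v $ i * w $ (S - {i})))"
  proof (rule sum.cong[OF refl])
    fix i assume "i \<in> S"
    have "{(a, b). a \<in> {i} \<and> b \<in> S - {i} \<and> b < a} = Pair i ` {b\<in>S. b < i}"
      by auto
    then have "card {(a, b). a \<in> {i} \<and> b \<in> S - {i} \<and> b < a} = card {b\<in>S. b < i}"
      by (simp add: card_image inj_on_def)
    then show "?g {i} = (- 1) ^ card {b\<in>S. b < i} * (v $ i * w $ (S - {i}))"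
      by (simp add: wedge_sign_def vec_mv_def)
  qed
  finally show ?thesis .
qed

lemma wedge_vec_same: "wedge (vec_mv u) (wedge (vec_mv u) w) = 0"
proof -
  have "wedge (vec_mv u) (wedge (vec_mv u) w) $ S = 0" for S
  proof -
    let ?s = "\<lambda>i. (- 1 :: real) ^ card {b\<in>S. b < i}"
    define g where "g i j = (if i = j then 0
      else (if i < j then - 1 else 1) * ?s i * ?s j * u $ i * u $ j * w $ (S - {i, j}))" for i j
    have sgn: "(- 1 :: real) ^ card {b \<in> S - {i}. b < j} = (if i < j then - 1 else 1) * ?s j"
      if "i \<in> S" for i j
    proof (cases "i < j")
      case True
      then have "{b\<in>S. b < j} = insert i {b \<in> S - {i}. b < j}" using that by auto
      then have "card {b\<in>S. b < j} = Suc (card {b \<in> S - {i}. b < j})" by simp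
      then show ?thesis using True by simp
    next
      case False
      then have "{b \<in> S - {i}. b < j} = {b\<in>S. b < j}" by auto
      then show ?thesis using False by simp
    qed
    have "wedge (vec_mv u) (wedge (vec_mv u) w) $ S = (\<Sum>i\<in>S. \<Sum>j\<in>S. g i j)"
      unfolding wedge_vec_nth[of _ _ S]
    proof (rule sum.cong[OF refl])
      fix i assume i: "i \<in> S"
      have "?s i * (u $ i * wedge (vec_mv u) w $ (S - {i})) = (\<Sum>j\<in>S - {i}. g i j)"
        unfolding wedge_vec_nth sum_distrib_left sgn[OF i]
        by (rule sum.cong) (auto simp: g_def insert_commute Diff_insert2[symmetric] mult_ac)
      also have "\<dots> = (\<Sum>j\<in>S. g i j)"
        by (rule sum.mono_neutral_left) (auto simp: g_def)
      finally show "?s i * (u $ i * wedge (vec_mv u) w $ (S - {i})) = (\<Sum>j\<in>S. g i j)" .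
    qed
    moreover have "(\<Sum>i\<in>S. \<Sum>j\<in>S. g i j) = - (\<Sum>i\<in>S. \<Sum>j\<in>S. g i j)"
    proof -
      have anti: "g j i = - g i j" for i j
        by (cases i j rule: linorder_cases) (auto simp: g_def insert_commute mult_ac)
      have "(\<Sum>i\<in>S. \<Sum>j\<in>S. g i j) = (\<Sum>i\<in>S. \<Sum>j\<in>S. g j i)"
        by (rule sum.swap)
      also have "\<dots> = (\<Sum>i\<in>S. \<Sum>j\<in>S. - g i j)"
        by (intro sum.cong refl) (rule anti)
      finally show ?thesis
        by (simp add: sum_negf)
    qed
    ultimately show ?thesis by simp
  qed
  then show ?thesis by (simp add: vec_eq_iff)
qed

lemma wedge_vec_anticommute:
  "wedge (vec_mv u) (wedge (vec_mv v) w) = - wedge (vec_mv v) (wedge (vec_mv u) w)"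
proof -
  have "0 = wedge (vec_mv (u + v)) (wedge (vec_mv (u + v)) w)"
    by (simp add: wedge_vec_same)
  also have "\<dots> = wedge (vec_mv u) (wedge (vec_mv v) w) + wedge (vec_mv v) (wedge (vec_mv u) w)"
    by (simp add: vec_mv_add bilinear_ladd[OF bilinear_wedge] bilinear_radd[OF bilinear_wedge]
        wedge_vec_same)
  finally show ?thesis by (simp add: eq_neg_iff_add_eq_0)
qed

lemma wedge_family_empty [simp]: "wedge_family f {} = axis {} 1"
  by (simp add: wedge_family_def)

lemma wedge_family_insert_less:
  fixes f :: "'n \<Rightarrow> real ^ ('n::{finite,linorder})"
  assumes "\<forall>a\<in>A. m < a"
  shows "wedge_family f (insert m A) = wedge (vec_mv (f m)) (wedge_family f A)"
proof -
  have "m \<notin> A" using assms by blast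
  moreover have "Min (insert m A) = m"
    using assms by (intro Min_eqI) (auto intro: less_imp_le)
  ultimately have "sorted_list_of_set (insert m A) = m # sorted_list_of_set A"
    by (subst sorted_list_of_set_nonempty) auto
  then show ?thesis by (simp add: wedge_family_def)
qed

lemma finite_linorder_set_induct [case_names empty insert]:
  fixes A :: "'n::{finite,linorder} set"
  assumes "P {}" and "\<And>m A. \<forall>a\<in>A. m < a \<Longrightarrow> P A \<Longrightarrow> P (insert m A)"
  shows "P A"
  using finite[of A] by (induction rule: finite_linorder_min_induct) (use assms in auto)

lemma wedge_family_axis: "wedge_family (\<lambda>i. axis i 1) S = axis S 1"
proof (induction S rule: finite_linorder_set_induct)
  case (insert m A)
  have *: "wedge (vec_mv (axis m 1)) (axis A 1) $ T = axis (insert m A) 1 $ T" for T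
  proof -
    have "wedge (vec_mv (axis m 1)) (axis A 1) $ T
        = (\<Sum>i\<in>T. if i = m then (- 1) ^ card {b\<in>T. b < m} * (axis A 1 $ (T - {m})) else 0)"
      unfolding wedge_vec_nth by (rule sum.cong) (auto simp: axis_def)
    also have "\<dots> = (if m \<in> T then (- 1) ^ card {b\<in>T. b < m} * (axis A 1 $ (T - {m})) else 0)"
      by simp
    also have "\<dots> = axis (insert m A) 1 $ T"
    proof (cases "T = insert m A")
      case True
      have "{b\<in>T. b < m} = {}" and "T - {m} = A"
        using insert(1) True by fastforce+
      then show ?thesis using True by (simp add: axis_def del: Collect_empty_eq)
    next
      case False
      then show ?thesis by (auto simp: axis_def)
    qed
    finally show ?thesis .
  qed
  then show ?case
    by (simp add: wedge_family_insert_less[OF insert(1)] insert(2)) (simp add: vec_eq_iff *)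
qed simp

lemma wedge_vec_wedge_family:
  "wedge (vec_mv (g i)) (wedge_family g S) =
     (if i \<in> S then 0 else (- 1) ^ card {b\<in>S. b < i} *\<^sub>R wedge_family g (insert i S))"
proof (induction S rule: finite_linorder_set_induct)
  case empty
  then show ?case using wedge_family_insert_less[of "{}" i g] by simp
next
  case (insert m A)
  have mA: "m \<notin> A" using insert(1) by blast
  consider "i = m" | "i < m" | "m < i" by (meson linorder_cases)
  then show ?case
  proof cases
    case 1
    then show ?thesis by (simp add: wedge_family_insert_less[OF insert(1)] wedge_vec_same)
  next
    case 2
    then have lt: "\<forall>a\<in>insert m A. i < a"
      using insert(1) by fastforce
    then have "{b \<in> insert m A. b < i} = {}" and "i \<notin> insert m A"
      by fastforce+
    then show ?thesis
      by (simp only: wedge_family_insert_less[OF lt]) simp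
  next
    case 3
    then have lt: "\<forall>a\<in>insert i A. m < a" using insert(1) by blast
    have "{b \<in> insert m A. b < i} = insert m {b\<in>A. b < i}" using 3 by auto
    then have c: "card {b \<in> insert m A. b < i} = Suc (card {b\<in>A. b < i})" using mA by simp
    have "wedge (vec_mv (g i)) (wedge_family g (insert m A))
        = - wedge (vec_mv (g m)) (wedge (vec_mv (g i)) (wedge_family g A))"
      by (simp add: wedge_family_insert_less[OF insert(1)] wedge_vec_anticommute[of "g i"])
    also have "\<dots> = (if i \<in> A then 0
        else - ((- 1) ^ card {b\<in>A. b < i} *\<^sub>R wedge_family g (insert m (insert i A))))"
      by (simp add: insert(2) bilinear_rzero[OF bilinear_wedge] bilinear_rmul[OF bilinear_wedge]
          wedge_family_insert_less[OF lt])
    also have "\<dots> = (if i \<in> insert m A then 0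
        else (- 1) ^ card {b \<in> insert m A. b < i} *\<^sub>R wedge_family g (insert i (insert m A)))"
      using 3 unfolding c by (auto simp: insert_commute)
    finally show ?thesis .
  qed
qed

lemma linear_ext_map: "linear (ext_map T)"
  by (rule linearI) (simp_all add: ext_map_def algebra_simps sum.distrib scaleR_sum_right)

lemma ext_map_axis: "ext_map T (axis S 1) = wedge_family (\<lambda>i. T (axis i 1)) S"
proof -
  have "ext_map T (axis S 1)
      = (\<Sum>A\<in>UNIV. if A = S then wedge_family (\<lambda>i. T (axis i 1)) A else 0)"
    unfolding ext_map_def by (rule sum.cong) (auto simp: axis_def)
  then show ?thesis by simp
qed

lemma ext_map_wedge_vec:
  assumes "linear T"
  shows "ext_map T (wedge (vec_mv v) w) = wedge (vec_mv (T v)) (ext_map T w)"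
proof -
  interpret T: linear T by (rule assms)
  let ?f = "\<lambda>v w. ext_map T (wedge (vec_mv v) w)"
  let ?g = "\<lambda>v w. wedge (vec_mv (T v)) (ext_map T w)"
  note simps = vec_mv_add vec_mv_scale bilinear_ladd[OF bilinear_wedge]
    bilinear_radd[OF bilinear_wedge] bilinear_lmul[OF bilinear_wedge]
    bilinear_rmul[OF bilinear_wedge] linear_add[OF linear_ext_map]
    linear_scale[OF linear_ext_map] T.add T.scale
  have "bilinear ?f" and "bilinear ?g"
    unfolding bilinear_def by (auto intro!: linearI simp: simps)
  moreover have "?f x y = ?g x y" if "x \<in> Basis" "y \<in> Basis" for x y
  proof -
    obtain i S where x: "x = axis i 1" and y: "y = axis S 1"
      using \<open>x \<in> Basis\<close> \<open>y \<in> Basis\<close> by (auto simp: Basis_vec_def)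
    show ?thesis
      using wedge_vec_wedge_family[of "\<lambda>i. axis i 1" i S]
        wedge_vec_wedge_family[of "\<lambda>i. T (axis i 1)" i S]
      by (simp add: x y wedge_family_axis ext_map_axis linear_0[OF linear_ext_map]
          linear_scale[OF linear_ext_map] split: if_splits)
  qed
  ultimately have "?f = ?g"
    by (intro bilinear_eq_stdbasis) auto
  then show ?thesis by meson
qed

lemma ext_map_wedge_family:
  assumes "linear T"
  shows "ext_map T (wedge_family f A) = wedge_family (\<lambda>i. T (f i)) A"
proof (induction A rule: finite_linorder_set_induct)
  case empty
  show ?case by (simp add: ext_map_axis)
next
  case (insert m A)
  then show ?case
    by (simp add: wedge_family_insert_less ext_map_wedge_vec[OF assms])
qed

lemma linear_basis_proj: "linear (basis_proj F J)"
  by (rule linearI)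
    (simp_all add: basis_proj_def matrix_vector_right_distrib matrix_vector_mult_scaleR
      algebra_simps sum.distrib scaleR_sum_right)

lemma invertible_matrix_inv:
  assumes "invertible F"
  shows "F ** matrix_inv F = mat 1" and "matrix_inv F ** F = mat 1"
  using someI_ex[OF assms[unfolded invertible_def]] by (simp_all add: matrix_inv_def)

lemma basis_proj_column:
  assumes "invertible F"
  shows "basis_proj F J (column j F) = (if j \<in> J then column j F else 0)"
proof -
  have "matrix_inv F *v column j F = axis j 1"
    using invertible_matrix_inv(2)[OF assms]
    by (metis matrix_vector_mul_assoc matrix_vector_mul_lid matrix_vector_mult_basis)
  then have "basis_proj F J (column j F) = (\<Sum>i\<in>J. if i = j then column i F else 0)"
    unfolding basis_proj_def by (intro sum.cong) (auto simp: axis_def)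
  then show ?thesis by simp
qed

lemma ext_proj_wedge_family:
  assumes "invertible F"
  shows "ext_proj F J (wedge_family (\<lambda>j. column j F) A)
    = (if A \<subseteq> J then wedge_family (\<lambda>j. column j F) A else 0)"
  unfolding ext_proj_def ext_map_wedge_family[OF linear_basis_proj] basis_proj_column[OF assms]
proof (induction A rule: finite_linorder_set_induct)
  case (insert m A)
  then show ?case
    by (auto simp: wedge_family_insert_less bilinear_rzero[OF bilinear_wedge]
        bilinear_lzero[OF bilinear_wedge])
qed simp

lemma subspace_ext_power: "subspace (ext_power r)"
  by (auto simp: subspace_def ext_power_def) (metis add_0)

lemma wedge_family_in_ext_power: "wedge_family f A \<in> ext_power (card A)"
proof (induction A rule: finite_linorder_set_induct)
  case empty
  show ?case by (auto simp: ext_power_def axis_def)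
next
  case (insert m A)
  then have "m \<notin> A" by blast
  have "card S = card (insert m A)"
    if nz: "wedge (vec_mv (f m)) (wedge_family f A) $ S \<noteq> 0" for S
  proof -
    obtain i where "i \<in> S" "wedge_family f A $ (S - {i}) \<noteq> 0"
      using nz unfolding wedge_vec_nth by (metis (no_types, lifting) mult_zero_right sum.neutral)
    then show ?thesis
      using insert(2) \<open>m \<notin> A\<close>
      by (auto simp: ext_power_def) (metis card_Suc_Diff1 finite)
  qed
  then show ?case
    using insert by (auto simp: ext_power_def wedge_family_insert_less)
qed

lemma span_wedge_family_columns:
  assumes "invertible F"
  shows "span (wedge_family (\<lambda>j. column j F) ` {A. card A = r}) = ext_power r"
proof
  show "span (wedge_family (\<lambda>j. column j F) ` {A. card A = r}) \<subseteq> ext_power r"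
    using wedge_family_in_ext_power
    by (intro span_minimal subspace_ext_power) auto
next
  let ?B = "wedge_family (\<lambda>j. column j F) ` {A. card A = r}"
  let ?G = "(*v) (matrix_inv F)" and ?F = "(*v) F"
  have lin: "linear ?G" "linear ?F"
    by (simp_all add: matrix_vector_mul_linear)
  have FG: "F *v (matrix_inv F *v x) = x" for x
    using invertible_matrix_inv(1)[OF assms] by (simp add: matrix_vector_mul_assoc)
  have axis: "axis S 1 \<in> span ?B" if "card S = r" for S
  proof -
    define u where "u = ext_map ?G (axis S 1)"
    have u: "u \<in> ext_power r"
      using wedge_family_in_ext_power[of _ S] that by (simp add: u_def ext_map_axis)
    have "axis S 1 = ext_map ?F u"
      unfolding u_def ext_map_axis ext_map_wedge_family[OF lin(2)] FG wedge_family_axis ..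
    also have "\<dots> = (\<Sum>A\<in>UNIV. u $ A *\<^sub>R wedge_family (\<lambda>j. column j F) A)"
      by (simp add: ext_map_def matrix_vector_mult_basis)
    also have "\<dots> \<in> span ?B"
    proof (rule span_sum)
      fix A
      show "u $ A *\<^sub>R wedge_family (\<lambda>j. column j F) A \<in> span ?B"
      proof (cases "card A = r")
        case True
        then show ?thesis by (intro span_scale span_base) auto
      next
        case False
        then have "u $ A = 0" using u by (auto simp: ext_power_def)
        then show ?thesis by (simp add: span_zero)
      qed
    qed
    finally show ?thesis .
  qed
  show "ext_power r \<subseteq> span ?B"
  proof
    fix w :: "'a multivector"
    assume w: "w \<in> ext_power r"
    have "w = (\<Sum>S\<in>UNIV. w $ S *\<^sub>R axis S 1)"
      using basis_expansion[of w] by (simp add: scalar_mult_eq_scaleR)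
    also have "\<dots> \<in> span ?B"
    proof (rule span_sum)
      fix S
      show "w $ S *\<^sub>R axis S 1 \<in> span ?B"
      proof (cases "card S = r")
        case True
        then show ?thesis by (intro span_scale axis)
      next
        case False
        then have "w $ S = 0" using w by (auto simp: ext_power_def)
        then show ?thesis by (simp add: span_zero)
      qed
    qed
    finally show "w \<in> span ?B" .
  qed
qed

end

theory Submission
  imports Defs
begin

text \<open>
  The vectors \<open>f\<^sub>A\<close> with \<open>card A = r\<close> form a basis of \<open>\<And>\<^sup>r V\<close>, and each projection \<open>\<pi>\<^sub>J\<close> fixes or kills
  every one of them.  By the Steinitz exchange property there is a set \<open>\<B>\<close> of \<open>dim W\<close> index sets such
  that the \<open>f\<^sub>A\<close> with \<open>A \<notin> \<B>\<close> span a complement of \<open>W\<close> (lemma \<open>basis_complement\<close>).  Applying \<open>\<pi>\<^sub>J\<close> to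
  this decomposition, the image of \<open>\<And>\<^sup>r V\<close> has dimension the number of all \<open>A \<subseteq> J\<close>, whereas the
  complement contributes at most the number of \<open>A \<subseteq> J\<close> outside \<open>\<B>\<close>.  Hence \<open>dim \<pi>\<^sub>J(W)\<close> is at least
  the number of members of \<open>\<B>\<close> contained in \<open>J\<close> (lemma \<open>card_fixed_le_dim_image\<close>).

  It remains to average over \<open>J\<close>.  Writing \<open>N = n - d\<close>, every \<open>A\<close> lies in the same number
  \<open>(n - r) choose (N - r)\<close> of sets \<open>J\<close>, so some \<open>J\<close> contains at least the average number
  \<open>dim W * ((n - r) choose (N - r)) / (n choose N)\<close> of members of \<open>\<B>\<close>, and this average equals
  \<open>dim W * (N choose r) / (n choose r)\<close>.
\<close>

text \<open>
  Steinitz exchange: a basis of \<open>span W\<close> extends by members of \<open>E\<close> to a basis of \<open>span E\<close>, and \<open>B\<close>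
  consists of the members of \<open>E\<close> that are left over.
\<close>

lemma basis_complement:
  fixes W E :: "'a::euclidean_space set"
  assumes "independent E" and "W \<subseteq> span E"
  obtains B where "B \<subseteq> E" "card B = dim W" "E \<subseteq> span (W \<union> (E - B))"
proof -
  have finE: "finite E" using assms(1) by (rule independent_imp_finite)
  obtain C where C: "C \<subseteq> W" "independent C" "W \<subseteq> span C" "card C = dim W"
    using basis_exists by blast
  obtain D where D: "C \<subseteq> D" "D \<subseteq> C \<union> E" "independent D" "C \<union> E \<subseteq> span D"
    using maximal_independent_subset_extend[OF Un_upper1 C(2)] by blast
  have finD: "finite D" using D(3) by (rule independent_imp_finite)
  have "span D = span E"
  proof (rule span_eq[THEN iffD2], intro conjI)
    show "D \<subseteq> span E" using D(2) C(1) assms(2) span_superset[of E] by blast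
    show "E \<subseteq> span D" using D(4) by blast
  qed
  then have "card D = card E"
    using dim_span_eq_card_independent[OF D(3)] dim_span_eq_card_independent[OF assms(1)] by simp
  moreover have DC: "D - C \<subseteq> E" using D(2) by blast
  ultimately have "card (E - (D - C)) = dim W"
    using C(4) D(1) finD finE card_mono[OF finD D(1)]
    by (simp add: card_Diff_subset finite_subset)
  moreover have "E \<subseteq> span (W \<union> (E - (E - (D - C))))"
  proof -
    have "D \<subseteq> W \<union> (E - (E - (D - C)))" using DC C(1) by blast
    then show ?thesis using D(4) span_mono by blast
  qed
  ultimately show thesis using that[of "E - (D - C)"] by blast
qed

text \<open>
  The fixed basis vectors lie in the image of \<open>span E\<close>, to which the part spanned by \<open>E - B\<close>
  contributes at most the fixed vectors outside \<open>B\<close>; the image of \<open>W\<close> must account for the others.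
\<close>

lemma card_fixed_le_dim_image:
  fixes W E B :: "'a::euclidean_space set"
  assumes "linear T" and indep: "independent E" and "B \<subseteq> E"
    and span: "E \<subseteq> span (W \<union> (E - B))"
    and T: "\<And>e. e \<in> E \<Longrightarrow> T e = e \<or> T e = 0"
  shows "card {b \<in> B. T b = b} \<le> dim (T ` W)"
proof -
  define K where "K = {e \<in> E. T e = e}"
  have finE: "finite E" using indep by (rule independent_imp_finite)
  then have finK: "finite K" by (simp add: K_def)
  obtain C where C: "C \<subseteq> T ` W" "independent C" "T ` W \<subseteq> span C" "card C = dim (T ` W)"
    using basis_exists by blast
  have finC: "finite C" using C(2) by (rule independent_imp_finite)
  have "T ` (W \<union> (E - B)) \<subseteq> span (C \<union> (K - B))"
  proof
    fix y assume "y \<in> T ` (W \<union> (E - B))"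
    then consider "y \<in> T ` W" | "y \<in> K - B" | "y = 0"
      using T by (fastforce simp: K_def)
    then show "y \<in> span (C \<union> (K - B))"
    proof cases
      case 1
      then show ?thesis using C(3) span_mono[of C "C \<union> (K - B)"] by blast
    qed (auto intro: span_base span_zero)
  qed
  then have "span (T ` (W \<union> (E - B))) \<subseteq> span (C \<union> (K - B))"
    by (simp add: span_minimal)
  moreover have "K \<subseteq> T ` span (W \<union> (E - B))"
    using span by (force simp: K_def)
  ultimately have "K \<subseteq> span (C \<union> (K - B))"
    using linear_span_image[OF assms(1), of "W \<union> (E - B)"] by (metis subset_trans)
  moreover have "independent K"
    using indep by (rule independent_mono) (simp add: K_def)
  ultimately have "card K \<le> card (C \<union> (K - B))"
    using independent_span_bound[of "C \<union> (K - B)" K] finC finK by simp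
  also have "\<dots> \<le> dim (T ` W) + card (K - B)"
    using card_Un_le[of C "K - B"] C(4) by simp
  finally have "card (K \<inter> B) \<le> dim (T ` W)"
    using finK card_Int_Diff[of K B] by simp
  moreover have "K \<inter> B = {b \<in> B. T b = b}"
    using assms(3) by (auto simp: K_def)
  ultimately show ?thesis by simp
qed

lemma dim_ext_power:
  "dim (ext_power r :: ('n::{finite,linorder}) multivector set) = CARD('n) choose r"
proof -
  let ?A = "{A :: 'n set. card A = r}"
  let ?e = "\<lambda>A :: 'n set. axis A (1::real)"
  have "column j (mat 1) = axis j (1::real)" for j :: 'n
    by (simp add: column_def mat_def axis_def vec_eq_iff)
  moreover have inv: "invertible (mat 1 :: real ^ ('n::{finite,linorder}) ^ ('n::{finite,linorder}))"
    by (auto simp: invertible_def)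
  ultimately have "span (?e ` ?A) = (ext_power r :: 'n multivector set)"
    using span_wedge_family_columns[OF inv, of r] by (simp add: wedge_family_axis)
  moreover have "independent (?e ` ?A)"
    using independent_Basis by (rule independent_mono) (auto simp: Basis_vec_def)
  moreover have "card (?e ` ?A) = card ?A"
    by (rule card_image) (auto simp: inj_on_def axis_eq_axis)
  ultimately show ?thesis
    using dim_span_eq_card_independent[of "?e ` ?A"] n_subsets[of "UNIV :: 'n set" r] by simp
qed

text \<open>The \<open>f\<^sub>A\<close> span \<open>\<And>\<^sup>r V\<close>, and there are only as many index sets as its dimension.\<close>

lemma wedge_family_columns_basis:
  fixes F :: "real ^ ('n::{finite,linorder}) ^ ('n::{finite,linorder})"
  assumes "invertible F"
  shows "inj_on (wedge_family (\<lambda>j. column j F)) {A. card A = r}"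
    and "independent (wedge_family (\<lambda>j. column j F) ` {A. card A = r})"
proof -
  let ?f = "wedge_family (\<lambda>j. column j F)"
  let ?A = "{A :: 'n set. card A = r}"
  have cA: "card ?A = CARD('n) choose r"
    using n_subsets[of "UNIV :: 'n set" r] by simp
  have d: "dim (?f ` ?A) = CARD('n) choose r"
    using dim_span[of "?f ` ?A"] by (simp add: span_wedge_family_columns[OF assms] dim_ext_power)
  have "dim (?f ` ?A) \<le> card (?f ` ?A)" by (rule dim_le_card') simp
  moreover have "card (?f ` ?A) \<le> card ?A" by (rule card_image_le) simp
  ultimately have c: "card (?f ` ?A) = card ?A" using d cA by simp
  then show "inj_on ?f ?A" by (intro eq_card_imp_inj_on) simp_all
  show "independent (?f ` ?A)"
    using c d cA by (intro card_le_dim_spanning[of _ "?f ` ?A"]) (auto intro: span_base)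
qed

lemma card_supersets:
  fixes A :: "'a::finite set"
  assumes "card A \<le> N"
  shows "card {J. A \<subseteq> J \<and> card J = N} = (CARD('a) - card A) choose (N - card A)"
proof -
  have "bij_betw (\<lambda>J. J - A) {J. A \<subseteq> J \<and> card J = N} {K. K \<subseteq> - A \<and> card K = N - card A}"
  proof (rule bij_betwI[where g = "\<lambda>K. K \<union> A"])
    show "(\<lambda>K. K \<union> A) \<in> {K. K \<subseteq> - A \<and> card K = N - card A} \<rightarrow> {J. A \<subseteq> J \<and> card J = N}"
    proof
      fix K assume K: "K \<in> {K. K \<subseteq> - A \<and> card K = N - card A}"
      then have "K \<inter> A = {}" by blast
      then show "K \<union> A \<in> {J. A \<subseteq> J \<and> card J = N}"
        using K assms by (simp add: card_Un_disjoint)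
    qed
  qed (auto simp: card_Diff_subset)
  then have "card {J. A \<subseteq> J \<and> card J = N} = card {K. K \<subseteq> - A \<and> card K = N - card A}"
    by (rule bij_betw_same_card)
  then show ?thesis
    by (simp add: n_subsets Compl_eq_Diff_UNIV card_Diff_subset)
qed

text \<open>Both sides count the pairs \<open>A \<subseteq> J\<close> with \<open>A \<in> \<B>\<close> and \<open>card J = N\<close>.\<close>

lemma sum_card_contained:
  fixes \<B> :: "'a::finite set set"
  assumes "\<And>A. A \<in> \<B> \<Longrightarrow> card A = r" and "r \<le> N"
  shows "(\<Sum>J | card J = N. card {A \<in> \<B>. A \<subseteq> J}) = card \<B> * ((CARD('a) - r) choose (N - r))"
proof -
  have "(\<Sum>J | card J = N. card {A \<in> \<B>. A \<subseteq> J}) = (\<Sum>J | card J = N. \<Sum>A\<in>\<B>. if A \<subseteq> J then 1 else 0)"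
    by (simp add: sum.If_cases Int_def)
  also have "\<dots> = (\<Sum>A\<in>\<B>. \<Sum>J | card J = N. if A \<subseteq> J then 1 else 0)"
    by (rule sum.swap)
  also have "\<dots> = (\<Sum>A\<in>\<B>. card {J. A \<subseteq> J \<and> card J = N})"
    by (simp add: sum.If_cases Int_def conj_commute)
  also have "\<dots> = card \<B> * ((CARD('a) - r) choose (N - r))"
    using assms by (simp add: card_supersets)
  finally show ?thesis .
qed

theorem lemma3p4:
  fixes F :: "real ^ ('n::{finite,linorder}) ^ ('n::{finite,linorder})"
    and W :: "'n multivector set"
    and r d :: nat
  assumes "0 < r" and "r + d \<le> CARD('n)"
    and "invertible F"
    and "subspace W" and "W \<subseteq> ext_power r"
  shows "Max ((\<lambda>J. real (dim (ext_proj F J ` W)) / real ((CARD('n) - d) choose r))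
             ` {J :: 'n set. card J = CARD('n) - d})
         \<ge> real (dim W) / real (CARD('n) choose r)"
proof -
  define N where "N = CARD('n) - d"
  have N: "r \<le> N" "N \<le> CARD('n)" using assms(2) by (auto simp: N_def)
  let ?f = "wedge_family (\<lambda>j. column j F)"
  let ?A = "{A :: 'n set. card A = r}"
  let ?J = "{J :: 'n set. card J = N}"
  let ?M = "Max ((\<lambda>J. real (dim (ext_proj F J ` W)) / real (N choose r)) ` ?J)"
  note inj = wedge_family_columns_basis(1)[OF assms(3), of r]
  note indep = wedge_family_columns_basis(2)[OF assms(3), of r]
  have "W \<subseteq> span (?f ` ?A)"
    using assms(5) by (simp add: span_wedge_family_columns[OF assms(3)])
  then obtain B where B: "B \<subseteq> ?f ` ?A" "card B = dim W" "?f ` ?A \<subseteq> span (W \<union> (?f ` ?A - B))"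
    using basis_complement[OF indep] by blast
  then obtain \<B> where \<B>: "\<B> \<subseteq> ?A" "B = ?f ` \<B>" by (auto simp: subset_image_iff)
  have injB: "inj_on ?f \<B>" using inj \<B>(1) by (rule inj_on_subset)
  have card\<B>: "card \<B> = dim W" using B(2) \<B>(2) card_image[OF injB] by simp
  have contained: "card {A \<in> \<B>. A \<subseteq> J} \<le> dim (ext_proj F J ` W)" for J
  proof -
    have "card {A \<in> \<B>. A \<subseteq> J} = card (?f ` {A \<in> \<B>. A \<subseteq> J})"
      using injB by (intro card_image[symmetric]) (auto simp: inj_on_def)
    also have "\<dots> \<le> card {b \<in> B. ext_proj F J b = b}"
      by (rule card_mono) (auto simp: \<B>(2) ext_proj_wedge_family[OF assms(3)])
    also have "\<dots> \<le> dim (ext_proj F J ` W)"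
    proof (rule card_fixed_le_dim_image[OF _ indep B(1) B(3)])
      show "linear (ext_proj F J)" by (simp add: ext_proj_def linear_ext_map)
      show "ext_proj F J e = e \<or> ext_proj F J e = 0" if e: "e \<in> ?f ` ?A" for e
      proof -
        obtain A where "e = ?f A" using e by blast
        then show ?thesis using ext_proj_wedge_family[OF assms(3), of J A] by presburger
      qed
    qed
    finally show ?thesis .
  qed
  have pos: "N choose r > 0" "CARD('n) choose r > 0"
    using N by simp_all
  have bound: "real (card {A \<in> \<B>. A \<subseteq> J}) \<le> ?M * real (N choose r)" if "J \<in> ?J" for J
  proof -
    have "real (dim (ext_proj F J ` W)) / real (N choose r) \<le> ?M"
      using that by (intro Max_ge) auto
    then show ?thesis
      using contained[of J] pos(1) by (simp add: divide_le_eq)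
  qed
  have "real (dim W * ((CARD('n) - r) choose (N - r))) = (\<Sum>J\<in>?J. real (card {A \<in> \<B>. A \<subseteq> J}))"
    using sum_card_contained[of \<B> r N] \<B>(1) N(1) card\<B> by (force simp flip: of_nat_sum)
  also have "\<dots> \<le> (\<Sum>J\<in>?J. ?M * real (N choose r))"
    by (rule sum_mono) (rule bound)
  also have "\<dots> = ?M * real ((CARD('n) choose N) * (N choose r))"
    using n_subsets[of "UNIV :: 'n set" N] by simp
  also have "(CARD('n) choose N) * (N choose r) = (CARD('n) choose r) * ((CARD('n) - r) choose (N - r))"
    using N by (rule choose_mult)
  finally have "real (dim W) * real ((CARD('n) - r) choose (N - r))
      \<le> (?M * real (CARD('n) choose r)) * real ((CARD('n) - r) choose (N - r))"
    by (simp add: mult.assoc)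
  moreover have "(CARD('n) - r) choose (N - r) > 0" using N by simp
  ultimately have "real (dim W) \<le> ?M * real (CARD('n) choose r)"
    by (simp only: mult_le_cancel_right_pos of_nat_0_less_iff)
  then show ?thesis
    using pos(2) by (simp add: divide_le_eq N_def)
qed

end
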